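(* Let $\Bbbk$ be an algebraically closed field with $\mathrm{char}(\Bbbk)\neq 2$, let $\mu=(\mu_{ij})\in M(4,\Bbbk)$ have entries in $\Bbbk^\times$ with $\mu_{ii}=1$ for all $i$ and $\mu_{ij}\mu_{ji}=1$ for all $i\neq j$, and let $S$ be the $\Bbbk$-algebra on generators $z_1,z_2,z_3,z_4$ with defining relations $z_jz_i=\mu_{ij}z_iz_j$ for all $i,j$. Let $$Q = a_{11}z_1^2+a_{22}z_2^2+a_{33}z_3^2+a_{44}z_4^2+2a_{12}z_1z_2+2a_{13}z_1z_3+2a_{14}z_1z_4+2a_{23}z_2z_3+2a_{24}z_2z_4+2a_{34}z_3z_4 \in S_2,$$ where $a_{ij}\in\Bbbk$ for all $i$ and $j$, and let $M\in M^{\mu}(4,\Bbbk)$ be the $\mu$-symmetric matrix associated to $Q$. There exists $L\in S_1$ such that $Q=L^2$ if and only if $D_i(M)=0$ for all $i=1,\ldots,21$, where $D_1,\ldots,D_{21}$ are the functions on $M^{\mu}(4,\Bbbk)$ given in the context.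
   Context: $M(4,\Bbbk)$ is the space of $4\times 4$ matrices over $\Bbbk$. The algebra $S=T(V)/\langle z_jz_i-\mu_{ij}z_iz_j : i,j=1,\ldots,4\rangle$, where $T(V)$ is the tensor (free) algebra on $z_1,\ldots,z_4$, is graded with each $z_i$ in degree $1$; $S_i$ denotes the span of the homogeneous elements of degree $i$. A matrix $M\in M(4,\Bbbk)$ is called $\mu$-symmetric if $M_{ij}=\mu_{ij}M_{ji}$ for all $i,j$; $M^{\mu}(4,\Bbbk)$ is the set of $\mu$-symmetric matrices. There is a one-to-one correspondence $M^{\mu}(4,\Bbbk)\to S_2$, $M\mapsto z^TMz$, with $z=(z_1,\ldots,z_4)^T$. The $\mu$-symmetric matrix associated to $Q$ under this correspondence is $$M=\begin{bmatrix} a_{11} & a_{12} & a_{13} & a_{14}\\ \mu_{21}a_{12} & a_{22} & a_{23} & a_{24}\\ \mu_{31}a_{13} & \mu_{32}a_{23} & a_{33} & a_{34}\\ \mu_{41}a_{14} & \mu_{42}a_{24} & \mu_{43}a_{34} & a_{44}\end{bmatrix}.$$ The functions $D_i: M^{\mu}(4,\Bbbk)\to\Bbbk$, $1\le i\le 21$, are defined on such $M$ by: $D_1(M) = 4a_{12}^2 - (1+\mu_{12})^2a_{11}a_{22}$, $D_2(M) = 4a_{13}^2 - (1+\mu_{13})^2a_{11}a_{33}$, $D_3(M) = 4a_{14}^2 - (1+\mu_{14})^2a_{11}a_{44}$, $D_4(M) = 4a_{23}^2 - (1+\mu_{23})^2a_{22}a_{33}$, $D_5(M) = 4a_{24}^2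 - (1+\mu_{24})^2a_{22}a_{44}$, $D_6(M) = 4a_{34}^2 - (1+\mu_{34})^2a_{33}a_{44}$, $D_7(M) = 2(1+\mu_{23})a_{12}a_{13} - (1+\mu_{12})(1+\mu_{13})a_{11}a_{23}$, $D_8(M) = 2(1+\mu_{24})a_{12}a_{14} - (1+\mu_{12})(1+\mu_{14})a_{11}a_{24}$, $D_9(M) = 2(1+\mu_{13})a_{12}a_{23} - (1+\mu_{12})(1+\mu_{23})a_{13}a_{22}$, $D_{10}(M) = 2(1+\mu_{14})a_{12}a_{24} - (1+\mu_{12})(1+\mu_{24})a_{14}a_{22}$, $D_{11}(M) = 2(1+\mu_{34})a_{13}a_{14} - (1+\mu_{13})(1+\mu_{14})a_{11}a_{34}$, $D_{12}(M) = 2(1+\mu_{12})a_{13}a_{23} - (1+\mu_{13})(1+\mu_{23})a_{33}a_{12}$, $D_{13}(M) = 2(1+\mu_{14})a_{13}a_{34} - (1+\mu_{13})(1+\mu_{34})a_{33}a_{14}$, $D_{14}(M) = 2(1+\mu_{12})a_{14}a_{24} - (1+\mu_{14})(1+\mu_{24})a_{12}a_{44}$, $D_{15}(M) = 2(1+\mu_{13})a_{14}a_{34} - (1+\mu_{14})(1+\mu_{34})a_{13}a_{44}$, $D_{16}(M) = 2(1+\mu_{34})a_{23}a_{24} - (1+\mu_{23})(1+\mu_{24})a_{22}a_{34}$, $D_{17}(M) = 2(1+\mu_{24})a_{23}a_{34} - (1+\mu_{23})(1+\mu_{34})a_{33}a_{24}$, $D_{18}(M) = 2(1+\mu_{23})a_{24}a_{34}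 - (1+\mu_{24})(1+\mu_{34})a_{23}a_{44}$, $D_{19}(M) = (1+\mu_{13})(1+\mu_{24})a_{12}a_{34} - (1+\mu_{12})(1+\mu_{34})a_{13}a_{24}$, $D_{20}(M) = (1+\mu_{14})(1+\mu_{23})a_{13}a_{24} - (1+\mu_{13})(1+\mu_{24})a_{14}a_{23}$, $D_{21}(M) = (1+\mu_{12})(1+\mu_{34})a_{14}a_{23} - (1+\mu_{14})(1+\mu_{23})a_{12}a_{34}$. *)

theory Defs
  imports
    "HOL-Analysis.Cartesian_Space"
    "HOL-Library.Poly_Mapping"
    "HOL-Algebra.QuotRing"
    "HOL-Algebra.Algebraic_Closure_Type"
begin

unbundle no Formal_Power_Series.fps_syntax

text \<open>
  The free algebra on a set of letters is the monoid algebra of the free monoid of words.  The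
  multiplication of \<^typ>\<open>'m \<Rightarrow>\<^sub>0 'k\<close> is convolution with respect to an additively
  written, possibly non-commutative monoid, so concatenation of words is written as addition.
\<close>

datatype 'v fword = FWord (letters: "'v list")

instantiation fword :: (type) monoid_add
begin

definition zero_fword :: "'a fword" where
  "0 = FWord []"

definition plus_fword :: "'a fword \<Rightarrow> 'a fword \<Rightarrow> 'a fword" where
  "u + v = FWord (letters u @ letters v)"

instance
  by standard (simp_all add: zero_fword_def plus_fword_def)

end

type_synonym ('v, 'k) free_algebra = "'v fword \<Rightarrow>\<^sub>0 'k"

definition scal :: "'k \<Rightarrow> ('v, 'k::ring_1) free_algebra" where
  "scal c = Poly_Mapping.single 0 c"

definition gen :: "'v \<Rightarrow> ('v, 'k::ring_1) free_algebra" where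
  "gen i = Poly_Mapping.single (FWord [i]) 1"

definition homogeneous :: "nat \<Rightarrow> ('v, 'k::ring_1) free_algebra set" where
  "homogeneous d = {f. \<forall>w \<in> Poly_Mapping.keys f. length (letters w) = d}"

text \<open>
  Indices range over the four-element type \<^typ>\<open>4\<close>, whose elements are \<open>1, 2, 3, 4\<close>
  (with \<open>4 = 0\<close> in that type).
\<close>

abbreviation T :: "(4, 'k::field) free_algebra ring" where
  "T \<equiv> ring_of_type_algebra"

definition skew_relations :: "'k::field^4^4 \<Rightarrow> (4, 'k) free_algebra set" where
  "skew_relations \<mu> = {gen j * gen i - scal (\<mu> $ i $ j) * gen i * gen j | i j. True}"

definition skew_ideal :: "'k::field^4^4 \<Rightarrow> (4, 'k) free_algebra set" where
  "skew_ideal \<mu> = Idl\<^bsub>T\<^esub> (skew_relations \<mu>)"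

text \<open>
  \<open>Idl\<close> is the generated two-sided ideal; as the scalars are central in the free algebra,
  it is also a subspace.
\<close>

definition S :: "'k::field^4^4 \<Rightarrow> (4, 'k) free_algebra set ring" where
  "S \<mu> = T Quot skew_ideal \<mu>"

definition S_class :: "'k::field^4^4 \<Rightarrow> (4, 'k) free_algebra \<Rightarrow> (4, 'k) free_algebra set" where
  "S_class \<mu> f = skew_ideal \<mu> +>\<^bsub>T\<^esub> f"

definition S_deg :: "'k::field^4^4 \<Rightarrow> nat \<Rightarrow> (4, 'k) free_algebra set set" where
  "S_deg \<mu> d = S_class \<mu> ` homogeneous d"

definition mu_symmetric :: "'k::field^4^4 \<Rightarrow> ('k^4^4) set" where
  "mu_symmetric \<mu> = {M. \<forall>i j. M $ i $ j = \<mu> $ i $ j * M $ j $ i}"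

text \<open>The element $z^T M z$ of $S_2$.\<close>

definition quad_of_matrix :: "'k::field^4^4 \<Rightarrow> 'k^4^4 \<Rightarrow> (4, 'k) free_algebra set" where
  "quad_of_matrix \<mu> M =
     S_class \<mu> (\<Sum>i\<in>UNIV. \<Sum>j\<in>UNIV. gen i * scal (M $ i $ j) * gen j)"

definition D_list :: "'k::field^4^4 \<Rightarrow> 'k^4^4 \<Rightarrow> 'k list" where
  "D_list \<mu> M = (let m = (\<lambda>i j. 1 + \<mu> $ i $ j); a = (\<lambda>i j. M $ i $ j) in
   [4 * (a 1 2)^2 - (m 1 2)^2 * a 1 1 * a 2 2,
    4 * (a 1 3)^2 - (m 1 3)^2 * a 1 1 * a 3 3,
    4 * (a 1 4)^2 - (m 1 4)^2 * a 1 1 * a 4 4,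
    4 * (a 2 3)^2 - (m 2 3)^2 * a 2 2 * a 3 3,
    4 * (a 2 4)^2 - (m 2 4)^2 * a 2 2 * a 4 4,
    4 * (a 3 4)^2 - (m 3 4)^2 * a 3 3 * a 4 4,
    2 * m 2 3 * a 1 2 * a 1 3 - m 1 2 * m 1 3 * a 1 1 * a 2 3,
    2 * m 2 4 * a 1 2 * a 1 4 - m 1 2 * m 1 4 * a 1 1 * a 2 4,
    2 * m 1 3 * a 1 2 * a 2 3 - m 1 2 * m 2 3 * a 1 3 * a 2 2,
    2 * m 1 4 * a 1 2 * a 2 4 - m 1 2 * m 2 4 * a 1 4 * a 2 2,
    2 * m 3 4 * a 1 3 * a 1 4 - m 1 3 * m 1 4 * a 1 1 * a 3 4,
    2 * m 1 2 * a 1 3 * a 2 3 - m 1 3 * m 2 3 * a 3 3 * a 1 2,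
    2 * m 1 4 * a 1 3 * a 3 4 - m 1 3 * m 3 4 * a 3 3 * a 1 4,
    2 * m 1 2 * a 1 4 * a 2 4 - m 1 4 * m 2 4 * a 1 2 * a 4 4,
    2 * m 1 3 * a 1 4 * a 3 4 - m 1 4 * m 3 4 * a 1 3 * a 4 4,
    2 * m 3 4 * a 2 3 * a 2 4 - m 2 3 * m 2 4 * a 2 2 * a 3 4,
    2 * m 2 4 * a 2 3 * a 3 4 - m 2 3 * m 3 4 * a 3 3 * a 2 4,
    2 * m 2 3 * a 2 4 * a 3 4 - m 2 4 * m 3 4 * a 2 3 * a 4 4,
    m 1 3 * m 2 4 * a 1 2 * a 3 4 - m 1 2 * m 3 4 * a 1 3 * a 2 4,
    m 1 4 * m 2 3 * a 1 3 * a 2 4 - m 1 3 * m 2 4 * a 1 4 * a 2 3,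
    m 1 2 * m 3 4 * a 1 4 * a 2 3 - m 1 4 * m 2 3 * a 1 2 * a 3 4])"

text \<open>$D_1, \ldots, D_{21}$ are numbered from 1, list positions from 0.\<close>

definition D :: "'k::field^4^4 \<Rightarrow> nat \<Rightarrow> 'k^4^4 \<Rightarrow> 'k" where
  "D \<mu> i M = D_list \<mu> M ! (i - 1)"

lemma length_D_list: "length (D_list \<mu> M) = 21"
  by (simp add: D_list_def Let_def)

lemma ring_T: "ring (T :: (4, 'k::field) free_algebra ring)"
proof -
  have "\<exists>y. x + y = 0" for x :: "(4, 'k) free_algebra"
    using add.right_inverse by blast
  moreover have "\<exists>y. y + x = 0" for x :: "(4, 'k) free_algebra"
    using add.left_inverse by blast
  ultimately show ?thesis
    unfolding ring_of_type_algebra_def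
    by unfold_locales (auto simp: algebra_simps Units_def)
qed

lemma ideal_skew_ideal: "ideal (skew_ideal \<mu>) T"
  unfolding skew_ideal_def
  by (rule ring.genideal_ideal[OF ring_T]) (simp add: ring_of_type_algebra_def)

lemma S_class_eq_iff: "S_class \<mu> f = S_class \<mu> g \<longleftrightarrow> f - g \<in> skew_ideal \<mu>"
proof -
  interpret ideal "skew_ideal \<mu>" T by (rule ideal_skew_ideal)
  have neg: "\<ominus>\<^bsub>T\<^esub> x = - x" for x :: "(4, 'a) free_algebra"
    by (rule minus_equality) (simp_all add: ring_of_type_algebra_def)
  have "f \<ominus>\<^bsub>T\<^esub> g = f - g"
    by (simp add: a_minus_def neg) (simp add: ring_of_type_algebra_def)
  then show ?thesis
    unfolding S_class_def
    using quotient_eq_iff_same_a_r_cos[OF ideal_skew_ideal, of f g]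
    by (simp add: ring_of_type_algebra_def)
qed

text \<open>
  The matrix displayed next is $\mu$-symmetric and corresponds to the quadratic form with
  coefficients $a_{ii}$ and $2 a_{ij}$, $i < j$.
\<close>

definition displayed_matrix :: "'k::field^4^4 \<Rightarrow> (4 \<Rightarrow> 4 \<Rightarrow> 'k) \<Rightarrow> 'k^4^4" where
  "displayed_matrix \<mu> a = vector
    [vector [a 1 1, a 1 2, a 1 3, a 1 4],
     vector [\<mu> $ 2 $ 1 * a 1 2, a 2 2, a 2 3, a 2 4],
     vector [\<mu> $ 3 $ 1 * a 1 3, \<mu> $ 3 $ 2 * a 2 3, a 3 3, a 3 4],
     vector [\<mu> $ 4 $ 1 * a 1 4, \<mu> $ 4 $ 2 * a 2 4, \<mu> $ 4 $ 3 * a 3 4, a 4 4]]"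

lemma displayed_matrix_mu_symmetric:
  assumes "\<forall>i. \<mu> $ i $ i = 1" "\<forall>i j. i \<noteq> j \<longrightarrow> \<mu> $ i $ j * \<mu> $ j $ i = 1"
  shows "displayed_matrix \<mu> a \<in> mu_symmetric \<mu>"
  using assms by (simp add: mu_symmetric_def displayed_matrix_def forall_4 vector_def mult.assoc[symmetric])

lemma quad_of_displayed_matrix:
  assumes "\<forall>i j. i \<noteq> j \<longrightarrow> \<mu> $ i $ j * \<mu> $ j $ i = 1"
  shows "quad_of_matrix \<mu> (displayed_matrix \<mu> a) = S_class \<mu>
          (scal (a 1 1) * gen 1 ^ 2 + scal (a 2 2) * gen 2 ^ 2
         + scal (a 3 3) * gen 3 ^ 2 + scal (a 4 4) * gen 4 ^ 2
         + scal (2 * a 1 2) * gen 1 * gen 2 + scal (2 * a 1 3) * gen 1 * gen 3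
         + scal (2 * a 1 4) * gen 1 * gen 4 + scal (2 * a 2 3) * gen 2 * gen 3
         + scal (2 * a 2 4) * gen 2 * gen 4 + scal (2 * a 3 4) * gen 3 * gen 4)"
proof -
  interpret ideal "skew_ideal \<mu>" T by (rule ideal_skew_ideal)
  have sub: "skew_relations \<mu> \<subseteq> skew_ideal \<mu>"
    by (auto simp: skew_ideal_def genideal_def)
  have add_mem: "f + g \<in> skew_ideal \<mu>" if "f \<in> skew_ideal \<mu>" "g \<in> skew_ideal \<mu>" for f g
    using additive_subgroup.a_closed[OF is_additive_subgroup that] by (simp add: ring_of_type_algebra_def)
  have mult_mem: "f * g \<in> skew_ideal \<mu>" if "g \<in> skew_ideal \<mu>" for f g
    using I_l_closed[OF that, of f] by (simp add: ring_of_type_algebra_def)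
  have comm: "gen i * scal c = scal c * gen i" for i :: 4 and c :: 'a
    by (simp add: gen_def scal_def mult_single)
  have scal_mult: "scal c * (scal d * f) = scal (c * d) * f" for c d :: 'a and f :: "(4, 'a) free_algebra"
    by (simp add: mult.assoc[symmetric]) (simp add: scal_def mult_single)
  have scal_double: "scal (2 * c) = scal c + scal c" for c :: 'a
    by (simp add: scal_def single_add[symmetric])
  define r where "r i j = scal (\<mu> $ j $ i * a i j) * gen j * gen i - scal (a i j) * gen i * gen j" for i j
  have r_mem: "r i j \<in> skew_ideal \<mu>" if "i \<noteq> j" for i j
  proof -
    have "gen j * gen i - scal (\<mu> $ i $ j) * gen i * gen j \<in> skew_ideal \<mu>"
      using sub by (auto simp: skew_relations_def)
    from mult_mem[OF this, of "scal (\<mu> $ j $ i * a i j)"]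
    have "scal (\<mu> $ j $ i * a i j) * (gen j * gen i)
        - scal (\<mu> $ j $ i * a i j * \<mu> $ i $ j) * (gen i * gen j) \<in> skew_ideal \<mu>"
      by (simp add: right_diff_distrib scal_mult mult.assoc)
    moreover have "\<mu> $ j $ i * a i j * \<mu> $ i $ j = a i j"
      using assms that by (metis mult.assoc mult.commute mult_1_right)
    ultimately show ?thesis by (simp only: r_def mult.assoc[of "scal _"])
  qed
  have "r 1 2 + r 1 3 + r 1 4 + r 2 3 + r 2 4 + r 3 4 \<in> skew_ideal \<mu>"
    by (intro add_mem r_mem) simp_all
  then show ?thesis
    unfolding quad_of_matrix_def S_class_eq_iff
    by (simp add: sum_4 displayed_matrix_def vector_def comm scal_double r_def power2_eq_square
          algebra_simps)
qed

end

theory Submission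
  imports Defs
begin

text \<open>
  Write \<open>L = l\<^sub>1 z\<^sub>1 + \<dots> + l\<^sub>4 z\<^sub>4\<close>.  Then \<open>L\<^sup>2 = z\<^sup>T (l l\<^sup>T) z\<close>, and two elements \<open>z\<^sup>T N z\<close> and
  \<open>z\<^sup>T P z\<close> agree in \<open>S\<close> exactly when \<open>N - P\<close> is \<open>\<mu>\<close>-antisymmetric, that is, when
  \<open>N\<^sub>i\<^sub>j + \<mu>\<^sub>i\<^sub>j N\<^sub>j\<^sub>i\<close> and \<open>P\<^sub>i\<^sub>j + \<mu>\<^sub>i\<^sub>j P\<^sub>j\<^sub>i\<close> coincide for all \<open>i, j\<close>
  (\<open>quad_form_in_skew_ideal_iff\<close>).  For a \<open>\<mu>\<close>-symmetric \<open>M\<close> this turns \<open>Q = L\<^sup>2\<close> into the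
  system \<open>2 M\<^sub>i\<^sub>j = (1 + \<mu>\<^sub>i\<^sub>j) l\<^sub>i l\<^sub>j\<close> in the unknown scalars \<open>l\<^sub>i\<close>
  (\<open>is_square_iff\<close>), and everything that is left is elimination over a field
  (\<open>root_coefficients_exist_iff\<close>).

  Put \<open>h\<^sub>i\<^sub>j = (1 + \<mu>\<^sub>i\<^sub>j) / 2\<close>, so that the system reads \<open>M\<^sub>i\<^sub>j = h\<^sub>i\<^sub>j l\<^sub>i l\<^sub>j\<close>.
  Substituting a solution into \<open>D\<^sub>1, \<dots>, D\<^sub>2\<^sub>1\<close> gives zero identically.  Conversely, the diagonal
  equations force \<open>l\<^sub>i = \<plusminus>r\<^sub>i\<close>, where \<open>r\<^sub>i\<close> is a fixed square root of \<open>M\<^sub>i\<^sub>i\<close>, and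
  \<open>D\<^sub>1, \<dots>, D\<^sub>6\<close> say that each \<open>M\<^sub>i\<^sub>j\<close> is \<open>\<plusminus>h\<^sub>i\<^sub>j r\<^sub>i r\<^sub>j\<close>.  So only signs have to be
  matched.  Consider the graph on the vertices 1, 2, 3, 4 with an edge wherever \<open>M\<^sub>i\<^sub>j \<noteq> 0\<close>, each
  edge carrying its sign.  A choice of signs for the \<open>r\<^sub>i\<close> that induces the signs of the
  edges exists if and only if every cycle contains an even number of negative edges.  Cycles in
  a graph on four vertices are triangles and quadrilaterals; the four triangles are controlled by
  \<open>D\<^sub>7, D\<^sub>8, D\<^sub>1\<^sub>1, D\<^sub>1\<^sub>6\<close> and the three quadrilaterals by \<open>D\<^sub>1\<^sub>9, D\<^sub>2\<^sub>0, D\<^sub>2\<^sub>1\<close>.  The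
  triangles alone do not suffice: if, say, \<open>\<mu>\<^sub>1\<^sub>3 = \<mu>\<^sub>2\<^sub>4 = -1\<close>, then
  \<open>M\<^sub>1\<^sub>3 = M\<^sub>2\<^sub>4 = 0\<close>, and the quadrilateral 1, 2, 3, 4 has no diagonals.
\<close>

section \<open>Words of length two modulo the skew relations\<close>

text \<open>
  Both sides of an identity that is bilinear in elements of the free algebra need to be compared on
  single words only; this rule performs that reduction.
\<close>
lemma poly_mapping_additive_induct [case_names zero single add]:
  fixes f :: "'a \<Rightarrow>\<^sub>0 'b::monoid_add"
  assumes "P 0" and "\<And>k c. P (Poly_Mapping.single k c)" and "\<And>f g. P f \<Longrightarrow> P g \<Longrightarrow> P (f + g)"
  shows "P f"
proof (induction f rule: Poly_Mapping.update_induct)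
  case (update f k c)
  then have "Poly_Mapping.update k c f = f + Poly_Mapping.single k c"
    by (intro poly_mapping_eqI)
      (auto simp: Poly_Mapping.lookup_update lookup_add lookup_single when_def in_keys_iff)
  then show ?case
    using assms(2,3) update.IH by simp
qed (rule assms(1))

text \<open>
  A product of two words equals \<open>ws\<close> only if it comes from cutting \<open>ws\<close> at one position,
  hence the convolution is a sum over the positions.
\<close>
lemma lookup_times_word:
  fixes f g :: "('v, 'k::ring_1) free_algebra"
  shows "Poly_Mapping.lookup (f * g) (FWord ws) =
    (\<Sum>k\<le>length ws. Poly_Mapping.lookup f (FWord (take k ws)) * Poly_Mapping.lookup g (FWord (drop k ws)))"
proof (induction f rule: poly_mapping_additive_induct)
  case (single u c)
  show ?case
  proof (induction g rule: poly_mapping_additive_induct)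
    case (single v d)
    show ?case
    proof (cases "ws = letters u @ letters v")
      case True
      have "(\<Sum>k\<le>length ws. Poly_Mapping.lookup (Poly_Mapping.single u c) (FWord (take k ws)) *
              Poly_Mapping.lookup (Poly_Mapping.single v d) (FWord (drop k ws)))
          = (\<Sum>k\<in>{length (letters u)}. c * d)"
      proof (rule sum.mono_neutral_cong_right)
        show "\<forall>k\<in>{..length ws} - {length (letters u)}.
            Poly_Mapping.lookup (Poly_Mapping.single u c) (FWord (take k ws)) *
            Poly_Mapping.lookup (Poly_Mapping.single v d) (FWord (drop k ws)) = 0"
          by (auto simp: lookup_single when_def)
      qed (use True in \<open>auto simp: lookup_single\<close>)
      then show ?thesis
        using True by (simp add: mult_single lookup_single plus_fword_def)
    next
      case False
      have "Poly_Mapping.lookup (Poly_Mapping.single u c) (FWord (take k ws)) *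
            Poly_Mapping.lookup (Poly_Mapping.single v d) (FWord (drop k ws)) = 0" for k
        using False by (auto simp: lookup_single when_def)
      then show ?thesis
        using False by (auto simp: mult_single lookup_single plus_fword_def when_def)
    qed
  qed (simp_all add: distrib_left lookup_add sum.distrib)
qed (simp_all add: distrib_right lookup_add sum.distrib)

text \<open>
  This is the part of the basis theorem for \<open>S\<close> that concerns degree two: the functionals
  \<open>f \<mapsto> f\<^sub>i\<^sub>j + \<mu>\<^sub>i\<^sub>j f\<^sub>j\<^sub>i\<close> are well defined on \<open>S\<close>.  Their common kernel for
  all \<open>i, j\<close> is not an ideal; the set \<open>J\<close> in the proof is one because it also prescribes zero
  coefficients in degrees 0 and 1, so that in degree two a multiplication by \<open>y\<close> acts through
  the constant term of \<open>y\<close>.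
\<close>
lemma skew_ideal_lookup_pair:
  fixes f :: "(4, 'k::field) free_algebra"
  assumes inv: "\<forall>i. \<mu> $ i $ i = 1" "\<forall>i j. i \<noteq> j \<longrightarrow> \<mu> $ i $ j * \<mu> $ j $ i = 1"
    and f: "f \<in> skew_ideal \<mu>"
  shows "Poly_Mapping.lookup f (FWord [i, j]) + \<mu> $ i $ j * Poly_Mapping.lookup f (FWord [j, i]) = 0"
proof -
  define J :: "(4, 'k) free_algebra set" where
    "J = {f. Poly_Mapping.lookup f (FWord []) = 0 \<and> (\<forall>i. Poly_Mapping.lookup f (FWord [i]) = 0) \<and>
      (\<forall>i j. Poly_Mapping.lookup f (FWord [i, j]) + \<mu> $ i $ j * Poly_Mapping.lookup f (FWord [j, i]) = 0)}"
  have neg: "\<ominus>\<^bsub>T\<^esub> x = - x" for x :: "(4, 'k) free_algebra"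
    by (rule abelian_group.minus_equality[OF ring.is_abelian_group[OF ring_T]])
       (simp_all add: ring_of_type_algebra_def)
  have "ideal J T"
  proof (rule idealI[OF ring_T])
    show "subgroup J (add_monoid T)"
    proof (rule group.subgroupI[OF abelian_group.a_group[OF ring.is_abelian_group[OF ring_T]]])
      show "inv\<^bsub>add_monoid T\<^esub> x \<in> J" if "x \<in> J" for x
      proof -
        have "- x \<in> J"
          using that by (simp add: J_def add_eq_0_iff)
        then show ?thesis
          by (simp add: neg[symmetric] a_inv_def)
      qed
      show "x \<otimes>\<^bsub>add_monoid T\<^esub> y \<in> J" if x: "x \<in> J" and y: "y \<in> J" for x y
      proof -
        have "Poly_Mapping.lookup x (FWord [i, j]) + Poly_Mapping.lookup y (FWord [i, j]) +
            \<mu> $ i $ j * (Poly_Mapping.lookup x (FWord [j, i]) + Poly_Mapping.lookup y (FWord [j, i])) =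
            (Poly_Mapping.lookup x (FWord [i, j]) + \<mu> $ i $ j * Poly_Mapping.lookup x (FWord [j, i])) +
            (Poly_Mapping.lookup y (FWord [i, j]) + \<mu> $ i $ j * Poly_Mapping.lookup y (FWord [j, i]))" for i j
          by (simp add: algebra_simps)
        also have "\<dots> i j = 0" for i j
          using x y by (simp add: J_def)
        finally show ?thesis
          using x y by (simp add: J_def ring_of_type_algebra_def lookup_add)
      qed
      have "0 \<in> J"
        by (simp add: J_def)
      then show "J \<noteq> {}"
        by blast
    qed (simp add: ring_of_type_algebra_def)
    fix x y :: "(4, 'k) free_algebra"
    assume x: "x \<in> J"
    have x0: "Poly_Mapping.lookup x (FWord []) = 0" and x1: "Poly_Mapping.lookup x (FWord [i]) = 0"
      and x2: "Poly_Mapping.lookup x (FWord [i, j]) + \<mu> $ i $ j * Poly_Mapping.lookup x (FWord [j, i]) = 0"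
      for i j
      using x by (auto simp: J_def)
    have "c * Poly_Mapping.lookup x (FWord [i, j]) + \<mu> $ i $ j * (c * Poly_Mapping.lookup x (FWord [j, i])) = 0"
      for c i j
      using arg_cong[OF x2[of i j], of "(*) c"] by (simp add: distrib_left mult.left_commute)
    then show "y \<otimes>\<^bsub>T\<^esub> x \<in> J" and "x \<otimes>\<^bsub>T\<^esub> y \<in> J"
      by (simp_all add: J_def ring_of_type_algebra_def lookup_times_word atMost_Suc x0 x1
          mult.commute[of "Poly_Mapping.lookup x _"])
  qed
  moreover have "skew_relations \<mu> \<subseteq> J"
  proof -
    have "gen j * gen i - scal (\<mu> $ i $ j) * gen i * gen j \<in> J" for i j
    proof -
      have rel: "gen j * gen i - scal (\<mu> $ i $ j) * gen i * gen j =
          Poly_Mapping.single (FWord [j, i]) 1 - Poly_Mapping.single (FWord [i, j]) (\<mu> $ i $ j)"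
        by (simp add: gen_def scal_def mult_single plus_fword_def zero_fword_def)
      show ?thesis
      proof (cases "i = j")
        case True
        then show ?thesis
          unfolding rel by (simp add: inv(1) J_def)
      next
        case False
        then have inverse: "\<mu> $ j $ i * \<mu> $ i $ j = 1"
          using inv(2) by simp
        define F where "F = Poly_Mapping.single (FWord [j, i]) 1 - Poly_Mapping.single (FWord [i, j]) (\<mu> $ i $ j)"
        have F: "Poly_Mapping.lookup F w =
            (if FWord [j, i] = w then 1 else 0) - (if FWord [i, j] = w then \<mu> $ i $ j else 0)" for w
          by (simp add: F_def lookup_minus lookup_single when_def)
        have "Poly_Mapping.lookup F (FWord [p, q]) + \<mu> $ p $ q * Poly_Mapping.lookup F (FWord [q, p]) = 0" for p q
        proof -
          consider "p = j" "q = i" | "p = i" "q = j"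
            | "FWord [j, i] \<noteq> FWord [p, q]" "FWord [j, i] \<noteq> FWord [q, p]"
              "FWord [i, j] \<noteq> FWord [p, q]" "FWord [i, j] \<noteq> FWord [q, p]"
            by auto
          then show ?thesis
          proof cases
            case 1
            then show ?thesis
              using False inverse by (simp add: F)
          next
            case 2
            then show ?thesis
              using False by (simp add: F)
          next
            case 3
            then show ?thesis
              by (simp only: F if_False diff_self mult_zero_right add_0)
          qed
        qed
        moreover have "Poly_Mapping.lookup F (FWord []) = 0" "Poly_Mapping.lookup F (FWord [p]) = 0" for p
          by (simp_all add: F)
        ultimately show ?thesis
          unfolding rel F_def[symmetric] J_def by blast
      qed
    qed
    then show ?thesis
      by (auto simp: skew_relations_def)
  qed
  ultimately have "skew_ideal \<mu> \<subseteq> J"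
    unfolding skew_ideal_def by (rule ring.genideal_minimal[OF ring_T])
  then show ?thesis
    using f by (auto simp: J_def)
qed

text \<open>
  The representative of \<open>quad_of_matrix \<mu> N\<close> in the free algebra, from which the entries of \<open>N\<close>
  can be read off.
\<close>
definition quad_form :: "'k::field^4^4 \<Rightarrow> (4, 'k) free_algebra" where
  "quad_form N = (\<Sum>i\<in>UNIV. \<Sum>j\<in>UNIV. gen i * scal (N $ i $ j) * gen j)"

lemma gen_scal_gen: "gen i * scal c * gen j = Poly_Mapping.single (FWord [i, j]) c"
  by (simp add: gen_def scal_def mult_single plus_fword_def zero_fword_def)

lemma lookup_quad_form: "Poly_Mapping.lookup (quad_form N) (FWord [i, j]) = N $ i $ j"
proof -
  have "Poly_Mapping.lookup (quad_form N) (FWord [i, j]) =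
      (\<Sum>k\<in>UNIV. \<Sum>l\<in>UNIV. if k = i then if l = j then N $ k $ l else 0 else 0)"
    unfolding quad_form_def gen_scal_gen lookup_sum
    by (intro sum.cong refl) (auto simp: lookup_single when_def)
  also have "\<dots> = (\<Sum>k\<in>UNIV. if k = i then \<Sum>l\<in>UNIV. if l = j then N $ k $ l else 0 else 0)"
    by (intro sum.cong refl) auto
  finally show ?thesis
    by simp
qed

lemma quad_form_diff: "quad_form (N - P) = quad_form N - quad_form P"
  by (simp add: quad_form_def gen_scal_gen single_diff sum_subtractf)

text \<open>
  One direction reads off coefficients.  For the other, \<open>\<mu>\<close>-antisymmetry of \<open>N\<close> turns
  \<open>N\<^sub>j\<^sub>i z\<^sub>j z\<^sub>i + N\<^sub>i\<^sub>j z\<^sub>i z\<^sub>j\<close> into the multiple \<open>N\<^sub>j\<^sub>i (z\<^sub>j z\<^sub>i - \<mu>\<^sub>i\<^sub>j z\<^sub>i z\<^sub>j)\<close> of a relation.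
  Summing over all ordered pairs produces \<open>z\<^sup>T N z\<close> twice, so each multiple is halved.
\<close>
lemma quad_form_in_skew_ideal_iff:
  fixes N :: "'k::field^4^4"
  assumes two: "(2::'k) \<noteq> 0"
    and inv: "\<forall>i. \<mu> $ i $ i = 1" "\<forall>i j. i \<noteq> j \<longrightarrow> \<mu> $ i $ j * \<mu> $ j $ i = 1"
  shows "quad_form N \<in> skew_ideal \<mu> \<longleftrightarrow> (\<forall>i j. N $ i $ j + \<mu> $ i $ j * N $ j $ i = 0)"
proof
  assume "quad_form N \<in> skew_ideal \<mu>"
  then show "\<forall>i j. N $ i $ j + \<mu> $ i $ j * N $ j $ i = 0"
    using skew_ideal_lookup_pair[OF inv, of "quad_form N"] by (simp add: lookup_quad_form)
next
  assume N: "\<forall>i j. N $ i $ j + \<mu> $ i $ j * N $ j $ i = 0"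
  interpret ideal "skew_ideal \<mu>" T by (rule ideal_skew_ideal)
  have zero: "0 \<in> skew_ideal \<mu>"
    using additive_subgroup.zero_closed[OF is_additive_subgroup] by (simp add: ring_of_type_algebra_def)
  have add: "f + g \<in> skew_ideal \<mu>" if "f \<in> skew_ideal \<mu>" "g \<in> skew_ideal \<mu>" for f g
    using additive_subgroup.a_closed[OF is_additive_subgroup that]
    by (simp add: ring_of_type_algebra_def)
  have sum: "(\<Sum>i\<in>A. F i) \<in> skew_ideal \<mu>" if "\<And>i. i \<in> A \<Longrightarrow> F i \<in> skew_ideal \<mu>"
    for A :: "4 set" and F
    using that by (induction A rule: infinite_finite_induct) (auto simp: zero add)
  have mult: "f * g \<in> skew_ideal \<mu>" if "g \<in> skew_ideal \<mu>" for f g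
    using I_l_closed[OF that, of f] by (simp add: ring_of_type_algebra_def)
  define R where "R i j = scal (N $ j $ i / 2) * (gen j * gen i - scal (\<mu> $ i $ j) * gen i * gen j)"
    for i j
  have R: "R i j = Poly_Mapping.single (FWord [j, i]) (N $ j $ i / 2)
        + Poly_Mapping.single (FWord [i, j]) (N $ i $ j / 2)" for i j
  proof -
    have "N $ i $ j = - (\<mu> $ i $ j * N $ j $ i)"
      using N by (metis eq_neg_iff_add_eq_0)
    then have "N $ i $ j / 2 = - (N $ j $ i / 2 * \<mu> $ i $ j)"
      by simp
    then have "R i j = Poly_Mapping.single (FWord [j, i]) (N $ j $ i / 2)
        - Poly_Mapping.single (FWord [i, j]) (- (N $ i $ j / 2))"
      by (simp only: minus_minus) (simp add: R_def gen_def scal_def mult_single plus_fword_def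
          zero_fword_def right_diff_distrib)
    then show ?thesis
      by (simp add: single_uminus)
  qed
  have half: "Poly_Mapping.single w (c / 2) + Poly_Mapping.single w (c / 2) = Poly_Mapping.single w c"
    for w :: "4 fword" and c :: 'k
  proof -
    have "c / 2 + c / 2 = c"
      using two by (simp flip: add_divide_distrib mult_2)
    then show ?thesis
      by (simp flip: single_add)
  qed
  have "quad_form N = (\<Sum>i\<in>UNIV. \<Sum>j\<in>UNIV. Poly_Mapping.single (FWord [i, j]) (N $ i $ j / 2))
      + (\<Sum>i\<in>UNIV. \<Sum>j\<in>UNIV. Poly_Mapping.single (FWord [i, j]) (N $ i $ j / 2))"
    by (simp add: quad_form_def gen_scal_gen half flip: sum.distrib)
  also have "\<dots> = (\<Sum>i\<in>UNIV. \<Sum>j\<in>UNIV. R i j)"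
    unfolding R sum.distrib by (subst sum.swap) simp
  also have "\<dots> \<in> skew_ideal \<mu>"
  proof (intro sum)
    fix i j
    have "gen j * gen i - scal (\<mu> $ i $ j) * gen i * gen j \<in> skew_ideal \<mu>"
      by (auto simp: skew_ideal_def genideal_def skew_relations_def)
    then show "R i j \<in> skew_ideal \<mu>"
      unfolding R_def by (rule mult)
  qed
  finally show "quad_form N \<in> skew_ideal \<mu>" .
qed

section \<open>Squares of linear forms\<close>

lemma S_class_power2: "S_class \<mu> f [^]\<^bsub>S \<mu>\<^esub> (2::nat) = S_class \<mu> (f * f)"
proof -
  interpret I: ideal "skew_ideal \<mu>" T by (rule ideal_skew_ideal)
  have hom: "S_class \<mu> \<in> ring_hom T (S \<mu>)"
    using I.rcos_ring_hom unfolding S_class_def S_def by simp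
  interpret Q: ring "S \<mu>"
    unfolding S_def by (rule I.quotient_is_ring)
  have "S_class \<mu> f \<in> carrier (S \<mu>)"
    using ring_hom_closed[OF hom, of f] by (simp add: ring_of_type_algebra_def)
  then have "S_class \<mu> f [^]\<^bsub>S \<mu>\<^esub> (2::nat) = S_class \<mu> f \<otimes>\<^bsub>S \<mu>\<^esub> S_class \<mu> f"
    by (simp add: numeral_2_eq_2)
  also have "\<dots> = S_class \<mu> (f * f)"
    using ring_hom_mult[OF hom, of f f] by (simp add: ring_of_type_algebra_def)
  finally show ?thesis .
qed

definition linear_form :: "(4 \<Rightarrow> 'k::field) \<Rightarrow> (4, 'k) free_algebra" where
  "linear_form l = (\<Sum>i\<in>UNIV. Poly_Mapping.single (FWord [i]) (l i))"

lemma homogeneous_1_eq: "homogeneous 1 = range (linear_form :: (4 \<Rightarrow> 'k::field) \<Rightarrow> _)"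
proof (intro equalityI subsetI)
  fix f :: "(4, 'k) free_algebra"
  assume f: "f \<in> homogeneous 1"
  have "f = linear_form (\<lambda>i. Poly_Mapping.lookup f (FWord [i]))"
  proof (rule poly_mapping_eqI)
    fix w :: "4 fword"
    show "Poly_Mapping.lookup f w = Poly_Mapping.lookup (linear_form (\<lambda>i. Poly_Mapping.lookup f (FWord [i]))) w"
    proof (cases "length (letters w) = 1")
      case True
      then obtain k where "w = FWord [k]"
        by (metis One_nat_def fword.collapse length_0_conv length_Suc_conv)
      then show ?thesis
        by (simp add: linear_form_def lookup_sum lookup_single when_def)
    next
      case False
      then have "w \<notin> Poly_Mapping.keys f" and "w \<noteq> FWord [i]" for i
        using f by (auto simp: homogeneous_def)
      then show ?thesis
        by (metis (no_types, lifting) in_keys_iff linear_form_def lookup_single_not_eq lookup_sum sum.neutral)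
    qed
  qed
  then show "f \<in> range linear_form"
    by blast
next
  fix f :: "(4, 'k) free_algebra"
  assume "f \<in> range linear_form"
  then obtain l where f: "f = linear_form l"
    by blast
  have "Poly_Mapping.lookup f w = 0" if "length (letters w) \<noteq> 1" for w
    using that by (auto simp: f linear_form_def lookup_sum lookup_single when_def intro!: sum.neutral)
  then show "f \<in> homogeneous 1"
    by (auto simp: homogeneous_def in_keys_iff)
qed

lemma linear_form_square: "linear_form l * linear_form l = quad_form (\<chi> i j. l i * l j)"
  by (simp add: linear_form_def quad_form_def gen_scal_gen sum_product mult_single plus_fword_def)

lemma is_square_iff:
  fixes M :: "'k::field^4^4"
  assumes two: "(2::'k) \<noteq> 0"
    and inv: "\<forall>i. \<mu> $ i $ i = 1" "\<forall>i j. i \<noteq> j \<longrightarrow> \<mu> $ i $ j * \<mu> $ j $ i = 1"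
    and M: "M \<in> mu_symmetric \<mu>"
  shows "(\<exists>L \<in> S_deg \<mu> 1. quad_of_matrix \<mu> M = L [^]\<^bsub>S \<mu>\<^esub> (2::nat))
     \<longleftrightarrow> (\<exists>l. \<forall>i j. 2 * M $ i $ j = (1 + \<mu> $ i $ j) * l i * l j)"
proof -
  have "(\<exists>L \<in> S_deg \<mu> 1. quad_of_matrix \<mu> M = L [^]\<^bsub>S \<mu>\<^esub> (2::nat))
     \<longleftrightarrow> (\<exists>l. quad_form (M - (\<chi> i j. l i * l j)) \<in> skew_ideal \<mu>)"
    unfolding S_deg_def homogeneous_1_eq bex_simps ball_simps S_class_power2 linear_form_square
      quad_of_matrix_def quad_form_def[symmetric] S_class_eq_iff quad_form_diff by blast
  also have "\<dots> \<longleftrightarrow> (\<exists>l. \<forall>i j. 2 * M $ i $ j = (1 + \<mu> $ i $ j) * l i * l j)"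
  proof -
    have "M $ i $ j - l i * l j + \<mu> $ i $ j * (M $ j $ i - l j * l i) = 0 \<longleftrightarrow>
        2 * M $ i $ j = (1 + \<mu> $ i $ j) * l i * l j" for l i j
    proof -
      have "M $ i $ j = \<mu> $ i $ j * M $ j $ i"
        using M unfolding mu_symmetric_def by blast
      then have "M $ i $ j - l i * l j + \<mu> $ i $ j * (M $ j $ i - l j * l i) =
          2 * M $ i $ j - (1 + \<mu> $ i $ j) * l i * l j"
        by (simp add: algebra_simps)
      then show ?thesis
        by (simp only: right_minus_eq)
    qed
    then show ?thesis
      by (simp add: quad_form_in_skew_ideal_iff[OF two inv])
  qed
  finally show ?thesis .
qed

section \<open>Choosing the signs of the square roots\<close>

text \<open>
  Harary's balance theorem for signed graphs, for graphs on four vertices: the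
  vertices can be labelled such that an edge is positive exactly when its ends carry equal labels,
  provided that each triangle and each quadrilateral has an even number of negative edges.  In
  terms of truth values, the product of two signs is the equivalence of the two values.  With the
  four labels expanded into their possible values, this is a propositional tautology.
\<close>
lemma balanced_signs_K4:
  fixes E pos :: "4 \<Rightarrow> 4 \<Rightarrow> bool"
  assumes "E 1 2 \<Longrightarrow> E 1 3 \<Longrightarrow> E 2 3 \<Longrightarrow> (pos 1 2 = pos 1 3) \<longleftrightarrow> pos 2 3"
    and "E 1 2 \<Longrightarrow> E 1 4 \<Longrightarrow> E 2 4 \<Longrightarrow> (pos 1 2 = pos 1 4) \<longleftrightarrow> pos 2 4"
    and "E 1 3 \<Longrightarrow> E 1 4 \<Longrightarrow> E 3 4 \<Longrightarrow> (pos 1 3 = pos 1 4) \<longleftrightarrow> pos 3 4"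
    and "E 2 3 \<Longrightarrow> E 2 4 \<Longrightarrow> E 3 4 \<Longrightarrow> (pos 2 3 = pos 2 4) \<longleftrightarrow> pos 3 4"
    and "E 1 2 \<Longrightarrow> E 3 4 \<Longrightarrow> E 1 3 \<Longrightarrow> E 2 4 \<Longrightarrow> (pos 1 2 = pos 3 4) \<longleftrightarrow> (pos 1 3 = pos 2 4)"
    and "E 1 3 \<Longrightarrow> E 2 4 \<Longrightarrow> E 1 4 \<Longrightarrow> E 2 3 \<Longrightarrow> (pos 1 3 = pos 2 4) \<longleftrightarrow> (pos 1 4 = pos 2 3)"
    and "E 1 2 \<Longrightarrow> E 3 4 \<Longrightarrow> E 1 4 \<Longrightarrow> E 2 3 \<Longrightarrow> (pos 1 4 = pos 2 3) \<longleftrightarrow> (pos 1 2 = pos 3 4)"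
  shows "\<exists>e :: 4 \<Rightarrow> bool. \<forall>(i, j) \<in> {(1, 2), (1, 3), (1, 4), (2, 3), (2, 4), (3, 4)}.
      E i j \<longrightarrow> (pos i j \<longleftrightarrow> e i = e j)"
proof -
  have "\<exists>e1 e2 e3 e4 :: bool.
      (E 1 2 \<longrightarrow> pos 1 2 = (e1 = e2)) \<and> (E 1 3 \<longrightarrow> pos 1 3 = (e1 = e3)) \<and>
      (E 1 4 \<longrightarrow> pos 1 4 = (e1 = e4)) \<and> (E 2 3 \<longrightarrow> pos 2 3 = (e2 = e3)) \<and>
      (E 2 4 \<longrightarrow> pos 2 4 = (e2 = e4)) \<and> (E 3 4 \<longrightarrow> pos 3 4 = (e3 = e4))"
    using assms by (simp only: ex_bool_eq simp_thms) sat
  then show ?thesis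
  proof (elim exE)
    fix e1 e2 e3 e4 :: bool
    assume "(E 1 2 \<longrightarrow> pos 1 2 = (e1 = e2)) \<and> (E 1 3 \<longrightarrow> pos 1 3 = (e1 = e3)) \<and>
      (E 1 4 \<longrightarrow> pos 1 4 = (e1 = e4)) \<and> (E 2 3 \<longrightarrow> pos 2 3 = (e2 = e3)) \<and>
      (E 2 4 \<longrightarrow> pos 2 4 = (e2 = e4)) \<and> (E 3 4 \<longrightarrow> pos 3 4 = (e3 = e4))"
    then show ?thesis
      by (intro exI[of _ "\<lambda>i. if i = 1 then e1 else if i = 2 then e2 else if i = 3 then e3 else e4"])
        simp
  qed
qed

lemma all_D_zero_iff:
  "(\<forall>i \<in> {1..21}. D \<mu> i M = 0) \<longleftrightarrow> (\<forall>x \<in> set (D_list \<mu> M). x = 0)"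
proof -
  have "(\<forall>i \<in> {1..21}. D \<mu> i M = 0) \<longleftrightarrow> (\<forall>i < 21. D_list \<mu> M ! i = 0)"
    unfolding D_def
  proof (intro iffI ballI allI impI)
    fix i :: nat
    assume "\<forall>i\<in>{1..21}. D_list \<mu> M ! (i - 1) = 0" "i < 21"
    then show "D_list \<mu> M ! i = 0"
      by (auto dest!: bspec[of _ _ "Suc i"])
  qed auto
  then show ?thesis
    by (simp add: all_set_conv_all_nth length_D_list)
qed

text \<open>
  A missing edge, \<open>M\<^sub>i\<^sub>j = 0\<close>, imposes no condition on the signs: then \<open>h\<^sub>i\<^sub>j r\<^sub>i r\<^sub>j = 0\<close>, whatever
  signs are given to \<open>r\<^sub>i\<close> and \<open>r\<^sub>j\<close>.  On the edges of a cycle all the factors \<open>h\<^sub>i\<^sub>j\<close> and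
  \<open>r\<^sub>i\<close> are nonzero, so they cancel from the equation \<open>D\<^sub>k = 0\<close> of that cycle and leave an
  equation between products of signs.
\<close>
lemma root_coefficients_exist_iff:
  fixes M :: "'k::alg_closed_field^4^4"
  assumes two: "(2::'k) \<noteq> 0"
    and inv: "\<forall>i. \<mu> $ i $ i = 1" "\<forall>i j. i \<noteq> j \<longrightarrow> \<mu> $ i $ j * \<mu> $ j $ i = 1"
    and M: "M \<in> mu_symmetric \<mu>"
  shows "(\<exists>l. \<forall>i j. 2 * M $ i $ j = (1 + \<mu> $ i $ j) * l i * l j)
     \<longleftrightarrow> (\<forall>x \<in> set (D_list \<mu> M). x = 0)"
proof -
  define h where "h i j = (1 + \<mu> $ i $ j) / 2" for i j
  have m: "1 + \<mu> $ i $ j = 2 * h i j" for i j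
    using two by (simp add: h_def)
  have hii: "h i i = 1" for i
    using inv(1) two by (simp add: h_def)
  \<comment> \<open>In terms of \<open>h\<close>, each \<open>D\<^sub>k\<close> is 4 times a polynomial in which no numerical factor is left.\<close>
  have D: "D_list \<mu> M = (let a = (\<lambda>i j. M $ i $ j) in map ((*) 4)
   [(a 1 2)^2 - (h 1 2)^2 * a 1 1 * a 2 2,
    (a 1 3)^2 - (h 1 3)^2 * a 1 1 * a 3 3,
    (a 1 4)^2 - (h 1 4)^2 * a 1 1 * a 4 4,
    (a 2 3)^2 - (h 2 3)^2 * a 2 2 * a 3 3,
    (a 2 4)^2 - (h 2 4)^2 * a 2 2 * a 4 4,
    (a 3 4)^2 - (h 3 4)^2 * a 3 3 * a 4 4,
    h 2 3 * a 1 2 * a 1 3 - h 1 2 * h 1 3 * a 1 1 * a 2 3,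
    h 2 4 * a 1 2 * a 1 4 - h 1 2 * h 1 4 * a 1 1 * a 2 4,
    h 1 3 * a 1 2 * a 2 3 - h 1 2 * h 2 3 * a 1 3 * a 2 2,
    h 1 4 * a 1 2 * a 2 4 - h 1 2 * h 2 4 * a 1 4 * a 2 2,
    h 3 4 * a 1 3 * a 1 4 - h 1 3 * h 1 4 * a 1 1 * a 3 4,
    h 1 2 * a 1 3 * a 2 3 - h 1 3 * h 2 3 * a 3 3 * a 1 2,
    h 1 4 * a 1 3 * a 3 4 - h 1 3 * h 3 4 * a 3 3 * a 1 4,
    h 1 2 * a 1 4 * a 2 4 - h 1 4 * h 2 4 * a 1 2 * a 4 4,
    h 1 3 * a 1 4 * a 3 4 - h 1 4 * h 3 4 * a 1 3 * a 4 4,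
    h 3 4 * a 2 3 * a 2 4 - h 2 3 * h 2 4 * a 2 2 * a 3 4,
    h 2 4 * a 2 3 * a 3 4 - h 2 3 * h 3 4 * a 3 3 * a 2 4,
    h 2 3 * a 2 4 * a 3 4 - h 2 4 * h 3 4 * a 2 3 * a 4 4,
    h 1 3 * h 2 4 * a 1 2 * a 3 4 - h 1 2 * h 3 4 * a 1 3 * a 2 4,
    h 1 4 * h 2 3 * a 1 3 * a 2 4 - h 1 3 * h 2 4 * a 1 4 * a 2 3,
    h 1 2 * h 3 4 * a 1 4 * a 2 3 - h 1 4 * h 2 3 * a 1 2 * a 3 4])"
    unfolding D_list_def Let_def m by (simp add: algebra_simps power2_eq_square)
  have four: "(4::'k) \<noteq> 0"
    using two by (metis mult_eq_0_iff numeral_Bit0_eq_double)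
  have "(\<exists>l. \<forall>i j. 2 * M $ i $ j = (1 + \<mu> $ i $ j) * l i * l j) \<longleftrightarrow>
      (\<exists>l. \<forall>i j. M $ i $ j = h i j * l i * l j)"
    using two by (simp add: m mult.assoc)
  also have "\<dots> \<longleftrightarrow> (\<forall>x \<in> set (D_list \<mu> M). x = 0)"
  proof
    assume "\<exists>l. \<forall>i j. M $ i $ j = h i j * l i * l j"
    then obtain l where "M $ i $ j = h i j * l i * l j" for i j
      by blast
    then show "\<forall>x \<in> set (D_list \<mu> M). x = 0"
      unfolding D Let_def by (simp add: hii power2_eq_square)
  next
    assume "\<forall>x \<in> set (D_list \<mu> M). x = 0"
    note D0 = this[unfolded D Let_def, simplified four list.map list.set ball_simps mult_eq_0_iff simp_thms]
    have "\<exists>r. r ^ 2 = M $ i $ i" for i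
      using nth_root_exists[of 2 "M $ i $ i"] by auto
    then obtain r where r: "M $ i $ i = r i ^ 2" for i
      by metis
    define E where "E i j \<longleftrightarrow> M $ i $ j \<noteq> 0" for i j
    define pos where "pos i j \<longleftrightarrow> M $ i $ j = h i j * r i * r j" for i j
    \<comment> \<open>A sign, given as a truth value, as an element of the field; this is injective because \<open>1 \<noteq> -1\<close>.\<close>
    define \<sigma> :: "bool \<Rightarrow> 'k" where "\<sigma> b = (if b then 1 else - 1)" for b
    have \<sigma>_mult: "\<sigma> b * \<sigma> c = \<sigma> (b = c)" for b c
      by (simp add: \<sigma>_def)
    have neg1: "(1::'k) \<noteq> - 1"
      using two by (metis add.right_inverse one_add_one)
    then have \<sigma>_inj: "\<sigma> b = \<sigma> c \<longleftrightarrow> b = c" for b c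
      using neg1[symmetric] by (simp add: \<sigma>_def)
    \<comment> \<open>The possible edges, in the orientation in which the \<open>D\<^sub>k\<close> use them; the remaining entries of
      \<open>M\<close> follow by \<open>\<mu>\<close>-symmetry.\<close>
    define U :: "(4 \<times> 4) set" where "U = {(1, 2), (1, 3), (1, 4), (2, 3), (2, 4), (3, 4)}"
    have U: "M $ i $ j = \<sigma> (pos i j) * (h i j * r i * r j)" if "(i, j) \<in> U" for i j
    proof -
      have "(M $ i $ j)\<^sup>2 = (h i j * r i * r j)\<^sup>2"
        using that D0 by (auto simp: U_def r power_mult_distrib)
      then show ?thesis
        by (auto simp: power2_eq_iff pos_def \<sigma>_def)
    qed
    have E: "h i j \<noteq> 0" "r i \<noteq> 0" "r j \<noteq> 0" if "(i, j) \<in> U" "E i j" for i j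
      using U[OF that(1)] that(2) by (auto simp: E_def)
    have triangle: "(pos i j = pos i k) \<longleftrightarrow> pos j k"
      if edges: "(i, j) \<in> U" "(i, k) \<in> U" "(j, k) \<in> U" "E i j" "E i k" "E j k"
        and zero: "h j k * M $ i $ j * M $ i $ k - h i j * h i k * M $ i $ i * M $ j $ k = 0" for i j k
    proof -
      have "h i j * h i k * h j k * r i ^ 2 * r j * r k * \<sigma> (pos i j = pos i k) =
          h i j * h i k * h j k * r i ^ 2 * r j * r k * \<sigma> (pos j k)"
        using zero unfolding r U[OF edges(1)] U[OF edges(2)] U[OF edges(3)] \<sigma>_mult[symmetric]
        by (simp add: algebra_simps power2_eq_square)
      then show ?thesis
        using E[OF edges(1,4)] E[OF edges(2,5)] E[OF edges(3,6)] by (simp add: \<sigma>_inj)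
    qed
    have quadrilateral: "(pos i j = pos k l) \<longleftrightarrow> (pos p q = pos s t)"
      if edges: "(i, j) \<in> U" "(k, l) \<in> U" "(p, q) \<in> U" "(s, t) \<in> U" "E i j" "E k l" "E p q" "E s t"
        and vertices: "r p * r q * r s * r t = r i * r j * r k * r l"
        and zero: "h p q * h s t * M $ i $ j * M $ k $ l - h i j * h k l * M $ p $ q * M $ s $ t = 0"
      for i j k l p q s t
    proof -
      have "(h i j * h k l * h p q * h s t) * (r i * r j * r k * r l) * \<sigma> (pos i j = pos k l) =
          (h i j * h k l * h p q * h s t) * (r p * r q * r s * r t) * \<sigma> (pos p q = pos s t)"
        using zero unfolding U[OF edges(1)] U[OF edges(2)] U[OF edges(3)] U[OF edges(4)] \<sigma>_mult[symmetric]
        by (simp add: algebra_simps)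
      then show ?thesis
        using E[OF edges(1,5)] E[OF edges(2,6)] E[OF edges(3,7)] E[OF edges(4,8)]
        by (simp add: \<sigma>_inj vertices)
    qed
    have "\<exists>e :: 4 \<Rightarrow> bool. \<forall>(i, j) \<in> U. E i j \<longrightarrow> (pos i j \<longleftrightarrow> e i = e j)"
      unfolding U_def
      by (rule balanced_signs_K4; rule triangle quadrilateral; (use D0 in blast | simp add: U_def mult_ac))
    then obtain e :: "4 \<Rightarrow> bool" where e: "pos i j \<longleftrightarrow> e i = e j" if "(i, j) \<in> U" "E i j" for i j
      by blast
    define l where "l i = \<sigma> (e i) * r i" for i
    have l_U: "M $ i $ j = h i j * l i * l j" if ij: "(i, j) \<in> U" for i j
    proof (cases "E i j")
      case True
      then show ?thesis
        using U[OF ij] e[OF ij] by (simp add: l_def \<sigma>_mult[symmetric] mult_ac)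
    next
      case False
      then show ?thesis
        using U[OF ij] by (auto simp: E_def l_def \<sigma>_def)
    qed
    have l_sym: "M $ j $ i = h j i * l j * l i" if "M $ i $ j = h i j * l i * l j" "i \<noteq> j" for i j
    proof -
      have "M $ j $ i = \<mu> $ j $ i * M $ i $ j"
        using M unfolding mu_symmetric_def by blast
      moreover have "h j i = \<mu> $ j $ i * h i j"
        using inv(2) that(2) by (simp add: h_def distrib_left add.commute)
      ultimately show ?thesis
        using that(1) by (simp add: mult_ac)
    qed
    have "M $ i $ j = h i j * l i * l j" for i j
    proof -
      consider "i = j" | "(i, j) \<in> U" | "(j, i) \<in> U" "i \<noteq> j"
        using exhaust_4[of i] exhaust_4[of j] by (auto simp: U_def)
      then show ?thesis
      proof cases
        case 1
        then show ?thesis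
          by (simp add: r hii l_def \<sigma>_def power2_eq_square)
      qed (use l_U l_sym in auto)
    qed
    then show "\<exists>l. \<forall>i j. M $ i $ j = h i j * l i * l j"
      by blast
  qed
  finally show ?thesis .
qed

theorem theorem2p2:
  fixes \<mu> M :: "'k::alg_closed_field^4^4"
    and a :: "4 \<Rightarrow> 4 \<Rightarrow> 'k"
    and Q :: "(4, 'k) free_algebra set"
  assumes "CHAR('k) \<noteq> 2"
    and "\<forall>i j. \<mu> $ i $ j \<noteq> 0"
    and "\<forall>i. \<mu> $ i $ i = 1"
    and "\<forall>i j. i \<noteq> j \<longrightarrow> \<mu> $ i $ j * \<mu> $ j $ i = 1"
    and "Q = S_class \<mu>
          (scal (a 1 1) * gen 1 ^ 2 + scal (a 2 2) * gen 2 ^ 2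
         + scal (a 3 3) * gen 3 ^ 2 + scal (a 4 4) * gen 4 ^ 2
         + scal (2 * a 1 2) * gen 1 * gen 2 + scal (2 * a 1 3) * gen 1 * gen 3
         + scal (2 * a 1 4) * gen 1 * gen 4 + scal (2 * a 2 3) * gen 2 * gen 3
         + scal (2 * a 2 4) * gen 2 * gen 4 + scal (2 * a 3 4) * gen 3 * gen 4)"
    and "M \<in> mu_symmetric \<mu>"
    and "quad_of_matrix \<mu> M = Q"
  shows "(\<exists>L \<in> S_deg \<mu> 1. Q = L [^]\<^bsub>S \<mu>\<^esub> (2::nat))
         \<longleftrightarrow> (\<forall>i \<in> {1..21}. D \<mu> i M = 0)"
proof -
  have two: "(2::'k) \<noteq> 0"
  proof
    assume "(2::'k) = 0"
    then have "CHAR('k) dvd 2"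
      by (metis of_nat_eq_0_iff_char_dvd of_nat_numeral)
    then have "CHAR('k) = 1"
      using assms(1) two_is_prime_nat by (auto simp: prime_nat_iff)
    then show False
      by simp
  qed
  show ?thesis
    using is_square_iff[OF two assms(3,4,6)] root_coefficients_exist_iff[OF two assms(3,4,6)]
    by (simp only: all_D_zero_iff assms(7))
qed

end
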